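(* (i) The eigenvalues of the operator $L_0$ are $z_n=(2n\pi)^3$, $n\in\mathbb{Z}$, and the multiplicity of each eigenvalue $z_n$ equals one. (ii) The eigenfunction of $L_0$ corresponding to $z_n$ is $u_n(0,x)=\mathrm{e}^{2n\pi\mathrm{i}x}$, $n\in\mathbb{Z}$.
   Context: $L_0$ is the operator in $L^2_{\mathbb{C}}(0,1)$ given by $(L_0y)(x)=\mathrm{i}y'''(x)$ with domain $\mathcal{D}(L_0)=\{y\in W_3^2(0,1): y(1)=y(0),\ y'(1)=y'(0),\ y''(1)=y''(0)\}$, where $W_3^2(0,1)$ is the Sobolev space of functions with three derivatives in $L^2$. The multiplicity of an eigenvalue is the dimension of its eigenspace. *)

theory Defs
  imports "HOL-Analysis.Analysis"
begin

abbreviation unit_measure :: "real measure" where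
  "unit_measure \<equiv> lebesgue_on {0<..<1}"

definition square_integrable :: "(real \<Rightarrow> complex) \<Rightarrow> bool" where
  "square_integrable f \<longleftrightarrow>
     f \<in> borel_measurable unit_measure \<and> integrable unit_measure (\<lambda>x. (cmod (f x))\<^sup>2)"

definition L2_eq :: "(real \<Rightarrow> complex) \<Rightarrow> (real \<Rightarrow> complex) \<Rightarrow> bool" where
  "L2_eq f g \<longleftrightarrow> square_integrable f \<and> square_integrable g \<and> (AE x in unit_measure. f x = g x)"

lemma square_integrable_0: "square_integrable (\<lambda>x. 0)"
  by (simp add: square_integrable_def)

lemma square_integrable_add:
  assumes "square_integrable f" "square_integrable g"
  shows "square_integrable (\<lambda>x. f x + g x)"
  unfolding square_integrable_def
proof
  show m: "(\<lambda>x. f x + g x) \<in> borel_measurable unit_measure"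
    using assms by (auto simp: square_integrable_def)
  have bd: "(cmod (a + b))\<^sup>2 \<le> 2 * (cmod a)\<^sup>2 + 2 * (cmod b)\<^sup>2" for a b :: complex
  proof -
    have "(cmod (a + b))\<^sup>2 \<le> (cmod a + cmod b)\<^sup>2"
      by (intro power_mono norm_triangle_ineq norm_ge_zero)
    also have "\<dots> \<le> 2 * (cmod a)\<^sup>2 + 2 * (cmod b)\<^sup>2"
      using zero_le_power2[of "cmod a - cmod b"] by (simp add: power2_eq_square algebra_simps)
    finally show ?thesis .
  qed
  show "integrable unit_measure (\<lambda>x. (cmod (f x + g x))\<^sup>2)"
  proof (rule Bochner_Integration.integrable_bound)
    show "integrable unit_measure (\<lambda>x. 2 * (cmod (f x))\<^sup>2 + 2 * (cmod (g x))\<^sup>2)"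
      using assms by (auto simp: square_integrable_def)
    show "(\<lambda>x. (cmod (f x + g x))\<^sup>2) \<in> borel_measurable unit_measure"
      using m by measurable
    show "AE x in unit_measure. norm ((cmod (f x + g x))\<^sup>2)
        \<le> norm (2 * (cmod (f x))\<^sup>2 + 2 * (cmod (g x))\<^sup>2)"
      using bd by (intro AE_I2) simp
  qed
qed

lemma square_integrable_scale:
  assumes "square_integrable f"
  shows "square_integrable (\<lambda>x. c * f x)"
  using assms by (auto simp: square_integrable_def norm_mult power_mult_distrib)

lemma square_integrable_uminus:
  assumes "square_integrable f"
  shows "square_integrable (\<lambda>x. - f x)"
  using square_integrable_scale[OF assms, of "-1"] by simp

lemma square_integrable_diff:
  assumes "square_integrable f" "square_integrable g"
  shows "square_integrable (\<lambda>x. f x - g x)"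
  using square_integrable_add[OF assms(1) square_integrable_uminus[OF assms(2)]] by simp

quotient_type L2 = "real \<Rightarrow> complex" / partial: L2_eq
  morphisms rep_L2 L2_class
proof (rule part_equivpI)
  show "\<exists>f. L2_eq f f"
    using square_integrable_0 by (auto simp: L2_eq_def)
  show "symp L2_eq"
    by (auto simp: symp_def L2_eq_def)
  show "transp L2_eq"
    by (auto simp: transp_def L2_eq_def)
qed

instantiation L2 :: ab_group_add
begin

lift_definition zero_L2 :: L2 is "\<lambda>x. 0"
  by (simp add: L2_eq_def square_integrable_0)

lift_definition plus_L2 :: "L2 \<Rightarrow> L2 \<Rightarrow> L2" is "\<lambda>f g x. f x + g x"
  by (auto simp: L2_eq_def square_integrable_add)

lift_definition uminus_L2 :: "L2 \<Rightarrow> L2" is "\<lambda>f x. - f x"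
  by (auto simp: L2_eq_def square_integrable_uminus)

lift_definition minus_L2 :: "L2 \<Rightarrow> L2 \<Rightarrow> L2" is "\<lambda>f g x. f x - g x"
  by (auto simp: L2_eq_def square_integrable_diff)

instance
proof
  fix a b c :: L2
  show "a + b + c = a + (b + c)"
    by transfer (simp add: L2_eq_def square_integrable_add add.assoc)
  show "a + b = b + a"
    by transfer (simp add: L2_eq_def square_integrable_add add.commute)
  show "0 + a = a"
    by transfer (simp add: L2_eq_def)
  show "- a + a = 0"
    by transfer (simp add: L2_eq_def square_integrable_0)
  show "a - b = a + - b"
    by transfer (simp add: L2_eq_def square_integrable_diff)
qed

end

lift_definition scaleC :: "complex \<Rightarrow> L2 \<Rightarrow> L2" (infixr \<open>*\<^sub>C\<close> 75) is "\<lambda>c f x. c * f x"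
  by (auto simp: L2_eq_def square_integrable_scale)

interpretation L2: vector_space scaleC
proof
  fix a b :: complex and x y :: L2
  show "a *\<^sub>C (x + y) = a *\<^sub>C x + a *\<^sub>C y"
    by transfer (simp add: L2_eq_def square_integrable_add square_integrable_scale distrib_left)
  show "(a + b) *\<^sub>C x = a *\<^sub>C x + b *\<^sub>C x"
    by transfer (simp add: L2_eq_def square_integrable_add square_integrable_scale distrib_right)
  show "a *\<^sub>C b *\<^sub>C x = (a * b) *\<^sub>C x"
    by transfer (simp add: L2_eq_def square_integrable_scale mult.assoc)
  show "1 *\<^sub>C x = x"
    by transfer (simp add: L2_eq_def)
qed

(* Real-valued test functions suffice: complex-valued ones give the same weak derivatives
   by linearity. *)
definition test_function :: "(real \<Rightarrow> real) \<Rightarrow> bool" where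
  "test_function \<phi> \<longleftrightarrow>
     (\<forall>k x. (deriv ^^ k) \<phi> field_differentiable (at x)) \<and>
     compact (closure {x. \<phi> x \<noteq> 0}) \<and> closure {x. \<phi> x \<noteq> 0} \<subseteq> {0<..<1}"

lemma test_function_borel_measurable:
  assumes "test_function \<phi>"
  shows "(deriv ^^ k) \<phi> \<in> borel_measurable unit_measure"
proof -
  have "continuous_on {0<..<1} ((deriv ^^ k) \<phi>)"
    using assms
    by (auto simp: test_function_def intro!: continuous_at_imp_continuous_on
        field_differentiable_imp_continuous_at)
  then show ?thesis
    by (intro continuous_imp_measurable_on_sets_lebesgue) auto
qed

lemma L2_eq_integral_mult:
  assumes "L2_eq f g" "\<psi> \<in> borel_measurable unit_measure"
  shows "(LINT x|unit_measure. f x * complex_of_real (\<psi> x))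
       = (LINT x|unit_measure. g x * complex_of_real (\<psi> x))"
proof (rule integral_cong_AE)
  have [measurable]: "f \<in> borel_measurable unit_measure" "g \<in> borel_measurable unit_measure"
    "\<psi> \<in> borel_measurable unit_measure"
    using assms by (auto simp: L2_eq_def square_integrable_def)
  show "(\<lambda>x. f x * complex_of_real (\<psi> x)) \<in> borel_measurable unit_measure"
    by measurable
  show "(\<lambda>x. g x * complex_of_real (\<psi> x)) \<in> borel_measurable unit_measure"
    by measurable
  show "AE x in unit_measure. f x * complex_of_real (\<psi> x) = g x * complex_of_real (\<psi> x)"
    using assms(1) by (auto simp: L2_eq_def)
qed

lift_definition has_weak_deriv :: "L2 \<Rightarrow> L2 \<Rightarrow> bool" is
  "\<lambda>f g. \<forall>\<phi>. test_function \<phi> \<longrightarrow>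
     (LINT x|unit_measure. f x * complex_of_real (deriv \<phi> x)) =
     - (LINT x|unit_measure. g x * complex_of_real (\<phi> x))"
proof -
  fix f f' g g'
  assume ff': "L2_eq f f'" and gg': "L2_eq g g'"
  have "(LINT x|unit_measure. f x * complex_of_real (deriv \<phi> x))
      = (LINT x|unit_measure. f' x * complex_of_real (deriv \<phi> x))"
    "(LINT x|unit_measure. g x * complex_of_real (\<phi> x))
      = (LINT x|unit_measure. g' x * complex_of_real (\<phi> x))" if "test_function \<phi>" for \<phi>
    using L2_eq_integral_mult[OF ff' test_function_borel_measurable[OF that, of 1]]
      L2_eq_integral_mult[OF gg' test_function_borel_measurable[OF that, of 0]]
    by simp_all
  then show "(\<forall>\<phi>. test_function \<phi> \<longrightarrow>
       (LINT x|unit_measure. f x * complex_of_real (deriv \<phi> x)) =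
       - (LINT x|unit_measure. g x * complex_of_real (\<phi> x))) =
     (\<forall>\<phi>. test_function \<phi> \<longrightarrow>
       (LINT x|unit_measure. f' x * complex_of_real (deriv \<phi> x)) =
       - (LINT x|unit_measure. g' x * complex_of_real (\<phi> x)))"
    by simp
qed

(* Weak derivatives are unique, so the description is proper whenever one exists. *)
definition weak_deriv :: "L2 \<Rightarrow> L2" where
  "weak_deriv f = (THE g. has_weak_deriv f g)"

definition sobolev :: "nat \<Rightarrow> L2 set" where
  "sobolev k = {f. \<forall>j<k. \<exists>g. has_weak_deriv ((weak_deriv ^^ j) f) g}"

lift_definition represents :: "(real \<Rightarrow> complex) \<Rightarrow> L2 \<Rightarrow> bool" is "\<lambda>F f. L2_eq F f"
  by (auto simp: L2_eq_def)

(* Boundary values are those of the representative that is continuous on the closed interval;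
   it is determined on {0..1} and exists for f in sobolev k with k > 0. *)
definition periodic_boundary :: "L2 \<Rightarrow> bool" where
  "periodic_boundary f \<longleftrightarrow>
     (\<exists>F. continuous_on {0..1} F \<and> represents F f \<and> F 1 = F 0)"

definition L0_domain :: "L2 set" where
  "L0_domain = {y \<in> sobolev 3. periodic_boundary y \<and>
     periodic_boundary (weak_deriv y) \<and> periodic_boundary ((weak_deriv ^^ 2) y)}"

definition L0 :: "L2 \<Rightarrow> L2" where
  "L0 y = \<i> *\<^sub>C (weak_deriv ^^ 3) y"

(* An unbounded operator is given by its domain D and a map A that is relevant on D only. *)
definition eigenfunction :: "L2 set \<Rightarrow> (L2 \<Rightarrow> L2) \<Rightarrow> complex \<Rightarrow> L2 \<Rightarrow> bool" where
  "eigenfunction D A z y \<longleftrightarrow> y \<in> D \<and> y \<noteq> 0 \<and> A y = z *\<^sub>C y"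

definition eigenvalue :: "L2 set \<Rightarrow> (L2 \<Rightarrow> L2) \<Rightarrow> complex \<Rightarrow> bool" where
  "eigenvalue D A z \<longleftrightarrow> (\<exists>y. eigenfunction D A z y)"

definition eigenspace :: "L2 set \<Rightarrow> (L2 \<Rightarrow> L2) \<Rightarrow> complex \<Rightarrow> L2 set" where
  "eigenspace D A z = {y \<in> D. A y = z *\<^sub>C y}"

definition multiplicity_eigenvalue :: "L2 set \<Rightarrow> (L2 \<Rightarrow> L2) \<Rightarrow> complex \<Rightarrow> nat" where
  "multiplicity_eigenvalue D A z = L2.dim (eigenspace D A z)"

definition zn :: "int \<Rightarrow> complex" where
  "zn n = complex_of_real ((2 * of_int n * pi) ^ 3)"

definition un :: "int \<Rightarrow> L2" where
  "un n = L2_class (\<lambda>x. exp (2 * of_int n * complex_of_real pi * \<i> * complex_of_real x))"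

end

theory Submission
  imports Defs
begin

text \<open>
  Weak derivatives are reduced to classical ones. The functions
  \<open>exp (- c / (x - a)) exp (- c / (b - x))\<close> on \<open>(a, b)\<close>, extended by 0, are test functions that
  tend to the indicator of \<open>(a, b)\<close> as \<open>c \<rightarrow> 0\<close>, so a function orthogonal to all test functions
  has integral 0 over every interval, hence vanishes almost everywhere. Thus weak derivatives are
  unique, a class with weak derivative zero is constant, and the continuous representatives of
  \<open>y, y', y''\<close> for an eigenfunction \<open>y\<close> satisfy \<open>y''' = \<kappa> y\<close> with \<open>\<kappa> = - i z\<close> classically.

  For each cube root \<open>a\<close> of \<open>\<kappa>\<close>, the function \<open>v\<^sub>a = y'' + a y' + a\<^sup>2 y\<close> is periodic and solves
  \<open>v' = a v\<close>, so it vanishes unless \<open>exp a = 1\<close>. Since \<open>\<Sum> a v\<^sub>a = 3 \<kappa> y\<close> and at most one cube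
  root of \<open>\<kappa> \<noteq> 0\<close> is purely imaginary, \<open>y\<close> is a multiple of \<open>exp (2 \<pi> i n x)\<close>. For \<open>\<kappa> = 0\<close>,
  periodicity forces \<open>y\<close> to be constant.
\<close>

section \<open>Smooth bump functions\<close>

text \<open>The polynomial factor makes this family closed under differentiation.\<close>

definition flat :: "real \<Rightarrow> real poly \<Rightarrow> real \<Rightarrow> real" where
  "flat c P x = (if x > 0 then poly P (1 / x) * exp (- c / x) else 0)"

text \<open>With \<open>y = 1 / x\<close> the claim becomes the decay of a polynomial times
  \<open>exp (- c * y)\<close> as \<open>y\<close> tends to infinity, which is checked monomial by
  monomial.\<close>

lemma flat_tendsto_0:
  assumes "c > 0"
  shows "(flat c P \<longlongrightarrow> 0) (at_right 0)"
proof -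
  have monom: "((\<lambda>y. y ^ k * exp (- c * y)) \<longlongrightarrow> 0) at_top" for k
  proof -
    have "filterlim (\<lambda>y. c * y) at_top at_top"
      using assms by (intro filterlim_tendsto_pos_mult_at_top[OF tendsto_const _ filterlim_ident])
    from filterlim_compose[OF tendsto_power_div_exp_0[of k] this]
    have "((\<lambda>y. 1 / c ^ k * ((c * y) ^ k / exp (c * y))) \<longlongrightarrow> 0) at_top"
      by (rule tendsto_mult_right_zero)
    then show ?thesis
      using assms by (simp add: power_mult_distrib exp_minus field_simps)
  qed
  have "((\<lambda>y. \<Sum>i\<le>degree P. coeff P i * (y ^ i * exp (- c * y))) \<longlongrightarrow> 0) at_top"
    by (intro tendsto_null_sum tendsto_mult_right_zero monom)
  then have "((\<lambda>y. poly P y * exp (- c * y)) \<longlongrightarrow> 0) at_top"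
    by (simp add: poly_altdef sum_distrib_right mult.assoc)
  from filterlim_compose[OF this filterlim_inverse_at_top_right]
  have "((\<lambda>x. poly P (1 / x) * exp (- c / x)) \<longlongrightarrow> 0) (at_right 0)"
    by (simp add: divide_inverse)
  then show ?thesis
    by (rule Lim_transform_eventually)
      (auto simp: flat_def eventually_at_filter)
qed

text \<open>Since \<open>1 / x\<close> has derivative \<open>- 1 / x^2\<close>, both product rule
  terms carry a factor \<open>1 / x^2\<close>; the polynomial \<open>[:0, 0, 1:]\<close> encodes
  it.\<close>

lemma flat_has_derivative:
  assumes "c > 0"
  shows "(flat c P has_field_derivative flat c ([:0, 0, 1:] * (smult c P - pderiv P)) x) (at x)"
proof -
  consider "x > 0" | "x < 0" | "x = 0" by linarith
  then show ?thesis
  proof cases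
    case 1
    have "((\<lambda>x. poly P (1 / x) * exp (- c / x)) has_field_derivative
        flat c ([:0, 0, 1:] * (smult c P - pderiv P)) x) (at x)"
      using 1 by (auto intro!: derivative_eq_intros DERIV_chain'[OF _ poly_DERIV]
          simp: flat_def field_simps power2_eq_square)
    then show ?thesis
      by (rule has_field_derivative_transform_within_open[where S = "{0<..}"])
        (use 1 in \<open>auto simp: flat_def\<close>)
  next
    case 2
    have "((\<lambda>x. 0) has_field_derivative 0) (at x)"
      by simp
    then have "(flat c P has_field_derivative 0) (at x)"
      by (rule has_field_derivative_transform_within_open[where S = "{..<0}"])
        (use 2 in \<open>auto simp: flat_def\<close>)
    then show ?thesis
      using 2 by (simp add: flat_def)
  next
    case 3
    have "((\<lambda>h. flat c P h / h) \<longlongrightarrow> 0) (at_left 0)"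
      by (rule Lim_transform_eventually[OF tendsto_const])
        (auto simp: flat_def eventually_at_filter)
    \<comment> \<open>For positive \<open>h\<close>, dividing by \<open>h\<close> multiplies the
      polynomial in \<open>1 / h\<close> by its variable, so the difference quotient is again a
      \<open>flat\<close> function, with \<open>pCons 0 P\<close>.\<close>
    moreover have "((\<lambda>h. flat c P h / h) \<longlongrightarrow> 0) (at_right 0)"
      by (rule Lim_transform_eventually[OF flat_tendsto_0[OF assms, of "pCons 0 P"]])
        (auto simp: flat_def eventually_at_filter)
    ultimately have "((\<lambda>h. flat c P h / h) \<longlongrightarrow> 0) (at 0)"
      by (simp add: filterlim_at_split)
    then show ?thesis
      using 3 by (simp add: DERIV_def flat_def)
  qed
qed

section \<open>Smoothness of functions on the line\<close>

definition smooth :: "(real \<Rightarrow> real) \<Rightarrow> bool" where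
  "smooth f \<longleftrightarrow> (\<forall>k x. (deriv ^^ k) f field_differentiable at x)"

text \<open>Every iterated derivative stays in \<open>P\<close> and is therefore differentiable.
  This proves smoothness by exhibiting a class closed under differentiation, without formulas for
  higher derivatives.\<close>

lemma smooth_coinduct:
  assumes "P f"
    and step: "\<And>f. P f \<Longrightarrow> \<exists>f'. P f' \<and> (\<forall>x. (f has_field_derivative f' x) (at x))"
  shows "smooth f"
proof -
  have "P ((deriv ^^ k) f)" for k
  proof (induction k)
    case (Suc k)
    then obtain f' where "P f'" "\<And>x. ((deriv ^^ k) f has_field_derivative f' x) (at x)"
      using step by blast
    then have "deriv ((deriv ^^ k) f) = f'"
      by (auto intro: DERIV_imp_deriv)
    then show ?case
      using \<open>P f'\<close> by simp
  qed (simp add: assms)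
  then show ?thesis
    unfolding smooth_def field_differentiable_def using step by blast
qed

lemma smooth_imp_DERIV:
  assumes "smooth f"
  shows "(f has_field_derivative deriv f x) (at x)"
  using assms[unfolded smooth_def, rule_format, of 0 x]
  by (simp add: DERIV_deriv_iff_field_differentiable)

lemma smooth_deriv:
  assumes "smooth f"
  shows "smooth (deriv f)"
  unfolding smooth_def
proof (intro allI)
  show "(deriv ^^ k) (deriv f) field_differentiable at x" for k x
    using assms[unfolded smooth_def, rule_format, of "Suc k" x] by (simp add: funpow_swap1)
qed

lemma smooth_diff_cmult:
  assumes "smooth f" "smooth g"
  shows "smooth (\<lambda>x. f x - c * g x)"
proof (rule smooth_coinduct[where P = "\<lambda>h. \<exists>f g. smooth f \<and> smooth g \<and> h = (\<lambda>x. f x - c * g x)"])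
  fix h
  assume "\<exists>f g. smooth f \<and> smooth g \<and> h = (\<lambda>x. f x - c * g x)"
  then obtain f g where fg: "smooth f" "smooth g" "h = (\<lambda>x. f x - c * g x)"
    by blast
  show "\<exists>h'. (\<exists>f g. smooth f \<and> smooth g \<and> h' = (\<lambda>x. f x - c * g x)) \<and>
      (\<forall>x. (h has_field_derivative h' x) (at x))"
  proof (intro exI conjI allI)
    show "smooth (deriv f)" "smooth (deriv g)"
      using fg by (auto intro: smooth_deriv)
    show "(h has_field_derivative deriv f x - c * deriv g x) (at x)" for x
      unfolding fg(3) by (intro DERIV_diff DERIV_cmult smooth_imp_DERIV fg)
  qed simp
qed (use assms in blast)

lemma smooth_antiderivative:
  assumes "smooth f'" "\<And>x. (f has_field_derivative f' x) (at x)"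
  shows "smooth f"
proof (rule smooth_coinduct[where P = "\<lambda>h. h = f \<or> smooth h"])
  fix h
  assume "h = f \<or> smooth h"
  then show "\<exists>h'. (h' = f \<or> smooth h') \<and> (\<forall>x. (h has_field_derivative h' x) (at x))"
    using assms smooth_deriv smooth_imp_DERIV by metis
qed simp

definition bump :: "real \<Rightarrow> real \<Rightarrow> real \<Rightarrow> real \<Rightarrow> real" where
  "bump c a b x = flat c 1 (x - a) * flat c 1 (b - x)"

text \<open>The product rule turns a product of this shape into a difference of two such products,
  the sign coming from the inner function \<open>b - x\<close>. Closing the products under
  differences thus gives a class closed under differentiation.\<close>

inductive bump_derivative :: "real \<Rightarrow> real \<Rightarrow> real \<Rightarrow> (real \<Rightarrow> real) \<Rightarrow> bool" for c a b where
  "bump_derivative c a b (\<lambda>x. flat c P (x - a) * flat c Q (b - x))"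
| "bump_derivative c a b f \<Longrightarrow> bump_derivative c a b g \<Longrightarrow> bump_derivative c a b (\<lambda>x. f x - g x)"

lemma smooth_bump:
  assumes "c > 0"
  shows "smooth (bump c a b)"
proof (rule smooth_coinduct[where P = "bump_derivative c a b"])
  show "bump_derivative c a b (bump c a b)"
    unfolding bump_def by (rule bump_derivative.intros)
next
  fix f
  assume "bump_derivative c a b f"
  then show "\<exists>f'. bump_derivative c a b f' \<and> (\<forall>x. (f has_field_derivative f' x) (at x))"
  proof induction
    case (1 P Q)
    define D where "D P = [:0, 0, 1:] * (smult c P - pderiv P)" for P
    show ?case
    proof (intro exI conjI allI)
      show "bump_derivative c a b (\<lambda>x. flat c (D P) (x - a) * flat c Q (b - x) -
          flat c P (x - a) * flat c (D Q) (b - x))"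
        by (intro bump_derivative.intros)
      have "((\<lambda>x. flat c P (x - a)) has_field_derivative flat c (D P) (x - a) * 1) (at x)" for x
        by (rule DERIV_chain'[OF _ flat_has_derivative[OF assms, folded D_def]])
          (auto intro!: derivative_eq_intros)
      moreover have "((\<lambda>x. flat c Q (b - x)) has_field_derivative flat c (D Q) (b - x) * (-1)) (at x)" for x
        by (rule DERIV_chain'[OF _ flat_has_derivative[OF assms, folded D_def]])
          (auto intro!: derivative_eq_intros)
      ultimately show "((\<lambda>x. flat c P (x - a) * flat c Q (b - x)) has_field_derivative
          flat c (D P) (x - a) * flat c Q (b - x) - flat c P (x - a) * flat c (D Q) (b - x)) (at x)" for x
        by (auto intro!: derivative_eq_intros)
    qed
  next
    case (2 f g)
    then obtain f' g' where "bump_derivative c a b f'" "\<And>x. (f has_field_derivative f' x) (at x)"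
        "bump_derivative c a b g'" "\<And>x. (g has_field_derivative g' x) (at x)"
      by blast
    then have "bump_derivative c a b (\<lambda>x. f' x - g' x)"
      "\<forall>x. ((\<lambda>x. f x - g x) has_field_derivative f' x - g' x) (at x)"
      by (auto intro!: bump_derivative.intros derivative_intros)
    then show ?case
      by blast
  qed
qed

section \<open>Test functions: supports, combinations and antiderivatives\<close>

lemma test_function_iff:
  "test_function \<phi> \<longleftrightarrow> smooth \<phi> \<and> (\<exists>a b. 0 < a \<and> a < b \<and> b < 1 \<and> (\<forall>x. x \<notin> {a..b} \<longrightarrow> \<phi> x = 0))"
    (is "_ \<longleftrightarrow> smooth \<phi> \<and> ?supp")
proof -
  let ?S = "closure {x. \<phi> x \<noteq> 0}"
  have "compact ?S \<and> ?S \<subseteq> {0<..<1} \<longleftrightarrow> ?supp"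
  proof
    assume S: "compact ?S \<and> ?S \<subseteq> {0<..<1}"
    \<comment> \<open>The support may be empty or a set without two extreme points at hand. Adding
      \<open>1/3\<close> and \<open>2/3\<close> ensures that minimum and maximum exist and satisfy
      \<open>a < b\<close>, and keeps the set inside the open unit interval.\<close>
    then have "compact (insert (1/3) (insert (2/3) ?S))" "insert (1/3) (insert (2/3) ?S) \<noteq> {}"
      by (auto intro: compact_insert)
    then obtain a b where ab: "a \<in> insert (1/3) (insert (2/3) ?S)" "\<forall>x\<in>insert (1/3) (insert (2/3) ?S). a \<le> x"
        "b \<in> insert (1/3) (insert (2/3) ?S)" "\<forall>x\<in>insert (1/3) (insert (2/3) ?S). x \<le> b"
      by (meson compact_attains_inf compact_attains_sup)
    have "\<phi> x = 0" if "x \<notin> {a..b}" for x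
      using that ab closure_subset[of "{x. \<phi> x \<noteq> 0}"] by auto
    moreover have "0 < a" "b < 1" "a < b"
      using ab S by auto
    ultimately show ?supp
      by blast
  next
    assume ?supp
    then obtain a b where ab: "0 < a" "b < 1" "\<And>x. x \<notin> {a..b} \<Longrightarrow> \<phi> x = 0"
      by blast
    then have "?S \<subseteq> {a..b}"
      by (intro closure_minimal) (force, simp)
    then show "compact ?S \<and> ?S \<subseteq> {0<..<1}"
      using ab(1,2) compact_Int_closed[of "{a..b}" ?S]
      by (auto simp: Int_absorb1)
  qed
  then show ?thesis
    by (auto simp: test_function_def smooth_def)
qed

lemma test_function_bump:
  assumes "c > 0" "0 < a" "a < b" "b < 1"
  shows "test_function (bump c a b)"
  unfolding test_function_iff using assms
  by (intro conjI exI[of _ a] exI[of _ b] smooth_bump) (auto simp: bump_def flat_def)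

lemma test_function_diff_cmult:
  assumes "test_function \<phi>" "test_function \<psi>"
  shows "test_function (\<lambda>x. \<phi> x - c * \<psi> x)"
proof -
  from assms obtain a b a' b' where *: "0 < a" "a < b" "b < 1" "\<forall>x. x \<notin> {a..b} \<longrightarrow> \<phi> x = 0"
    "0 < a'" "a' < b'" "b' < 1" "\<forall>x. x \<notin> {a'..b'} \<longrightarrow> \<psi> x = 0"
    unfolding test_function_iff by blast
  have "\<phi> x - c * \<psi> x = 0" if "x \<notin> {min a a'..max b b'}" for x
  proof -
    have "x \<notin> {a..b}" "x \<notin> {a'..b'}"
      using that by auto
    then show ?thesis
      using * by simp
  qed
  moreover have "0 < min a a'" "min a a' < max b b'" "max b b' < 1"
    using * by auto
  ultimately have "\<exists>a b. 0 < a \<and> a < b \<and> b < 1 \<and> (\<forall>x. x \<notin> {a..b} \<longrightarrow> \<phi> x - c * \<psi> x = 0)"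
    by blast
  then show ?thesis
    unfolding test_function_iff
    using assms[THEN test_function_iff[THEN iffD1], THEN conjunct1] smooth_diff_cmult by blast
qed

text \<open>The primitive starting at 0 vanishes to the left of the support of
  \<open>\<psi>\<close>; to the right it equals the total integral, which is 0. So its support stays
  in the same interval.\<close>

lemma test_function_antiderivative:
  assumes \<psi>: "test_function \<psi>" and int0: "(\<psi> has_integral 0) {0..1}"
  obtains \<phi> where "test_function \<phi>" "deriv \<phi> = \<psi>"
proof -
  from \<psi> obtain a b where ab: "0 < a" "a < b" "b < 1" and supp: "\<And>x. x \<notin> {a..b} \<Longrightarrow> \<psi> x = 0"
    unfolding test_function_iff by blast
  have smooth: "smooth \<psi>"
    using \<psi> by (simp add: test_function_iff)
  then have cont: "continuous_on A \<psi>" for A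
    by (meson DERIV_isCont continuous_at_imp_continuous_on smooth_imp_DERIV)
  define \<phi> where "\<phi> x = integral {0..x} \<psi>" for x
  have 0: "\<phi> x = 0" if "x < a" for x
  proof -
    have "integral {0..x} \<psi> = integral {0..x} (\<lambda>x. 0)"
      using that supp by (intro integral_cong) auto
    then show ?thesis
      by (simp add: \<phi>_def)
  qed
  have 1: "\<phi> x = 0" if "x > b" for x
  proof -
    have "integral {b..x} \<psi> = integral {b..x} (\<lambda>x. 0)" if "b \<le> x" for x
    \<comment> \<open>\<open>\<psi>\<close> is known to vanish only outside the closed interval, so
      the point \<open>b\<close> is discarded as a null set.\<close>
    proof (rule integral_spike[of "{b}"])
      show "0 = \<psi> y" if "y \<in> {b..x} - {b}" for y
        using that supp[of y] by auto
    qed auto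
    then have "integral {b..x} \<psi> = 0" "integral {b..1} \<psi> = 0"
      using that ab by auto
    moreover have "integral {0..b} \<psi> + integral {b..x} \<psi> = integral {0..x} \<psi>"
      "integral {0..b} \<psi> + integral {b..1} \<psi> = integral {0..1} \<psi>"
      using that ab by (auto intro!: Henstock_Kurzweil_Integration.integral_combine integrable_continuous_interval cont)
    ultimately show ?thesis
      using int0 by (simp add: \<phi>_def integral_unique)
  qed
  have D: "(\<phi> has_field_derivative \<psi> x) (at x)" for x
  proof (cases "x < a")
    case True
    have "((\<lambda>x. 0) has_field_derivative 0) (at x)"
      by simp
    then have "(\<phi> has_field_derivative 0) (at x)"
      by (rule has_field_derivative_transform_within_open[where S = "{..<a}"]) (use True 0 in auto)
    then show ?thesis
      using supp True by auto
  next
    case False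
    \<comment> \<open>The fundamental theorem gives a one-interval derivative; extending the
      interval to \<open>x + 1\<close> makes \<open>x\<close> interior, as
      \<open>x \<ge> a > 0\<close>.\<close>
    have "(\<phi> has_real_derivative \<psi> x) (at x within {0..x + 1})"
      unfolding \<phi>_def using False ab by (intro integral_has_real_derivative cont) auto
    then show ?thesis
      using False ab by (subst (asm) at_within_interior) auto
  qed
  show thesis
  proof
    show "test_function \<phi>"
      unfolding test_function_iff using smooth_antiderivative[OF smooth D] ab 0 1
      by (intro conjI exI[of _ a] exI[of _ b]) (auto simp: not_le)
    show "deriv \<phi> = \<psi>"
      using D by (auto intro: DERIV_imp_deriv)
  qed
qed

section \<open>Functions orthogonal to all test functions\<close>

lemma bump_le_1: "c > 0 \<Longrightarrow> \<bar>bump c a b x\<bar> \<le> 1"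
  by (auto simp: bump_def flat_def abs_mult intro!: mult_le_one)

text \<open>Inside the interval both exponents tend to 0; outside it one factor is 0 for every
  \<open>c\<close>.\<close>

lemma bump_tendsto_indicator:
  "(\<lambda>n. bump (1 / real (Suc n)) a b x) \<longlonglongrightarrow> indicator {a<..<b} x"
proof (cases "x \<in> {a<..<b}")
  case True
  have "(\<lambda>n. exp (- (1 / real (Suc n)) / (x - a)) * exp (- (1 / real (Suc n)) / (b - x)))
      \<longlonglongrightarrow> exp (- 0 / (x - a)) * exp (- 0 / (b - x))"
    using True by (intro tendsto_intros LIMSEQ_Suc[OF lim_1_over_n]) auto
  then show ?thesis
    using True by (simp add: bump_def flat_def)
next
  case False
  then have "bump c a b x = 0" for c
    by (auto simp: bump_def flat_def)
  then show ?thesis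
    using False by simp
qed

text \<open>Dominated convergence along the bumps with \<open>c = 1 / (n + 1)\<close>, with majorant
  \<open>cmod (f x)\<close>: all integrals in the sequence are 0 by orthogonality.\<close>

lemma set_integral_interval_eq_0:
  assumes f: "integrable unit_measure f"
    and orth: "\<And>\<phi>. test_function \<phi> \<Longrightarrow> (LINT x|unit_measure. f x * complex_of_real (\<phi> x)) = 0"
    and ab: "0 < a" "a < b" "b < 1"
  shows "(LINT x:{a<..<b}|unit_measure. f x) = 0"
proof -
  let ?b = "\<lambda>n. bump (1 / real (Suc n)) a b"
  have test: "test_function (?b n)" for n
    using ab by (intro test_function_bump) auto
  have [measurable]: "f \<in> borel_measurable unit_measure"
    using f by simp
  have [measurable]: "?b n \<in> borel_measurable unit_measure" for n
    using test_function_borel_measurable[OF test, where k = 0] by simp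
  have "(\<lambda>n. LINT x|unit_measure. f x * complex_of_real (?b n x))
      \<longlonglongrightarrow> (LINT x|unit_measure. f x * complex_of_real (indicator {a<..<b} x))"
  proof (rule integral_dominated_convergence)
    show "integrable unit_measure (\<lambda>x. cmod (f x))"
      using f by simp
    show "AE x in unit_measure. (\<lambda>n. f x * complex_of_real (?b n x))
        \<longlonglongrightarrow> f x * complex_of_real (indicator {a<..<b} x)"
      by (intro AE_I2 tendsto_intros bump_tendsto_indicator)
    show "AE x in unit_measure. cmod (f x * complex_of_real (?b n x)) \<le> cmod (f x)" for n
      by (intro AE_I2) (simp add: norm_mult mult_left_le bump_le_1)
    have "{a<..<b} \<in> sets unit_measure"
      using ab by (subst sets_restrict_space_iff) auto
    then have [measurable]: "indicat_real {a<..<b} \<in> borel_measurable unit_measure"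
      by (rule borel_measurable_indicator)
    show "(\<lambda>x. f x * complex_of_real (indicator {a<..<b} x)) \<in> borel_measurable unit_measure"
      by measurable
    show "(\<lambda>x. f x * complex_of_real (?b n x)) \<in> borel_measurable unit_measure" for n
      by measurable
  qed
  then show ?thesis
    unfolding orth[OF test]
    by (simp add: LIMSEQ_const_iff set_lebesgue_integral_def scaleR_conv_of_real mult.commute)
qed

text \<open>The integral of \<open>f\<close> is shown to vanish over ever larger classes of sets:
  open intervals up to the endpoints, Borel sets by a Dynkin argument, and Lebesgue sets modulo null
  sets. Then \<open>density_zero\<close> applies.\<close>

theorem test_function_orthogonal_imp_AE_0:
  assumes f: "integrable unit_measure f"
    and orth: "\<And>\<phi>. test_function \<phi> \<Longrightarrow> (LINT x|unit_measure. f x * complex_of_real (\<phi> x)) = 0"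
  shows "AE x in unit_measure. f x = 0"
proof -
  \<comment> \<open>Intersecting with the unit interval defines \<open>I\<close> on all Borel sets
    of the line, so that the induction can run over the full Borel sigma-algebra.\<close>
  define I where "I A = (LINT x:A \<inter> {0<..<1}|unit_measure. f x)" for A
  have sets: "A \<inter> {0<..<1} \<in> sets unit_measure" if "A \<in> sets borel" for A
    using that by (auto simp: sets_restrict_space)
  have int: "set_integrable unit_measure (A \<inter> {0<..<1}) f" if "A \<in> sets borel" for A
    unfolding set_integrable_def using sets[OF that] by (intro integrable_mult_indicator f)
  have interval: "I {a<..<b} = 0" if ab: "0 \<le> a" "a < b" "b \<le> 1" for a b
  proof -
    \<comment> \<open>Bumps need their support away from 0 and 1, so the interval is exhausted from
      inside. The denominator \<open>i + 3\<close> exceeds 2, which keeps every \<open>A i\<close>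
      nonempty.\<close>
    define d where "d i = (b - a) / real (i + 3)" for i
    define A where "A i = {a + d i<..<b - d i}" for i
    have less: "0 < d i" "d i < (b - a) / 2" for i
      unfolding d_def using ab by simp (rule divide_strict_left_mono, use ab in auto)
    have A0: "(LINT x:A i|unit_measure. f x) = 0" for i
      unfolding A_def
    proof (rule set_integral_interval_eq_0[OF f])
      show "0 < a + d i" "b - d i < 1"
        "a + d i < b - d i"
        using less[of i] ab by (auto simp: field_simps)
    qed (rule orth)
    have "(\<Union>i. A i) = {a<..<b}"
    proof (intro equalityI subsetI)
      fix x assume x: "x \<in> {a<..<b}"
      have "(\<lambda>i. d i) \<longlonglongrightarrow> 0"
        unfolding d_def by (intro LIMSEQ_ignore_initial_segment lim_const_over_n)
      then have "\<forall>\<^sub>F i in sequentially. d i < min (x - a) (b - x)"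
        by (rule order_tendstoD) (use x in auto)
      then obtain i where "d i < min (x - a) (b - x)"
        by (auto simp: eventually_sequentially)
      then show "x \<in> (\<Union>i. A i)"
        by (auto simp: A_def intro!: exI[of _ i])
    next
      fix x assume "x \<in> (\<Union>i. A i)"
      then obtain i where "x \<in> A i"
        by blast
      then show "x \<in> {a<..<b}"
        using less(1)[of i] by (auto simp: A_def)
    qed
    moreover have "(\<lambda>i. LINT x:A i|unit_measure. f x) \<longlonglongrightarrow> (LINT x:(\<Union>i. A i)|unit_measure. f x)"
    proof (rule set_integral_cont_up)
      show "A i \<in> sets unit_measure" for i
        using sets[of "A i"] less[of i] ab by (auto simp: A_def Int_absorb2 sets_restrict_space)
      show "incseq A"
      proof (rule incseq_SucI)
        show "A i \<subseteq> A (Suc i)" for i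
        proof -
          have "d (Suc i) \<le> d i"
            unfolding d_def using ab by (intro divide_left_mono) auto
          then show ?thesis
            by (auto simp: A_def)
        qed
      qed
      show "set_integrable unit_measure (\<Union>i. A i) f"
        using int[of "{a<..<b}"] ab \<open>(\<Union>i. A i) = {a<..<b}\<close> by (simp add: Int_absorb2)
    qed
    ultimately show ?thesis
      using ab by (simp add: A0 LIMSEQ_const_iff I_def Int_absorb2)
  qed
  have borel: "I A = 0" if "A \<in> sets borel" for A
  proof -
    let ?G = "range (\<lambda>(a, b). {a<..<b :: real})"
    have borel_eq: "borel = sigma UNIV ?G"
      using borel_eq_box[where 'a = real] by (simp add: box_real)
    have "Int_stable ?G"
      by (auto simp: Int_stable_def intro!: image_eqI[of _ _ "(max a c, min b d)" for a b c d])
    moreover have "?G \<subseteq> Pow UNIV"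
      by simp
    moreover have "A \<in> sigma_sets UNIV ?G"
      using that by (simp add: borel_eq)
    ultimately show ?thesis
    proof (induction rule: sigma_sets_induct_disjoint)
      case (basic B)
      then obtain a b where B: "B = {a<..<b}"
        by auto
      \<comment> \<open>Clipping to the unit interval does not change \<open>I\<close> and reduces
        to the case treated above, or to the empty set.\<close>
      then have "I B = I {max 0 a<..<min 1 b}"
        unfolding I_def by (intro arg_cong[where f = "\<lambda>A. set_lebesgue_integral _ A _"]) auto
      also have "\<dots> = 0"
      proof (cases "max 0 a < min 1 b")
        case True
        then show ?thesis by (intro interval) auto
      next
        case False
        then have "{max 0 a<..<min 1 b} = {}"
          by (intro greaterThanLessThan_empty) linarith
        then show ?thesis by (simp add: I_def set_lebesgue_integral_def)
      qed
      finally show ?case .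
    next
      case empty
      then show ?case by (simp add: I_def set_lebesgue_integral_def)
    next
      case (compl B)
      then have B: "B \<in> sets borel"
        by (simp add: borel_eq)
      \<comment> \<open>Additivity gives the complement as the difference of the whole interval and
        \<open>B\<close>, both with integral 0.\<close>
      have "I {0<..<1} = (LINT x:(B \<inter> {0<..<1}) \<union> ((UNIV - B) \<inter> {0<..<1})|unit_measure. f x)"
        unfolding I_def by (intro arg_cong[where f = "\<lambda>A. set_lebesgue_integral _ A _"]) auto
      also have "\<dots> = I B + I (UNIV - B)"
        unfolding I_def using B by (intro set_integral_Un int) auto
      finally show ?case
        using interval[of 0 1] compl by simp
    next
      case (union B)
      then have B: "B i \<in> sets borel" for i
        by (auto simp: borel_eq)
      have "I (\<Union>i. B i) = (LINT x:(\<Union>i. B i \<inter> {0<..<1})|unit_measure. f x)"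
        unfolding I_def by simp
      also have "\<dots> = (\<Sum>i. I (B i))"
        unfolding I_def
      proof (rule lebesgue_integral_countable_add)
        show "B i \<inter> {0<..<1} \<in> sets unit_measure" for i
          by (intro sets B)
        show "B i \<inter> {0<..<1} \<inter> (B j \<inter> {0<..<1}) = {}" if "i \<noteq> j" for i j
          using union(1) that by (auto simp: disjoint_family_on_def)
        show "set_integrable unit_measure (\<Union>i. B i \<inter> {0<..<1}) f"
          using int[of "\<Union>i. B i"] B by (simp add: Int_UN_distrib2)
      qed
      finally show ?case
        using union by simp
    qed
  qed
  interpret finite_measure unit_measure
    by (intro finite_measure_lebesgue_on) auto
  show ?thesis
  proof (rule density_zero[OF f])
    fix A
    assume A: "A \<in> sets unit_measure"
    then have "A \<subseteq> {0<..<1}" "A \<in> sets lebesgue"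
      by (auto simp: sets_restrict_space)
    \<comment> \<open>A Lebesgue set is a Borel set up to a subset of a Borel null set, so its
      integral is already known to be 0.\<close>
    then obtain S N N' where N: "A = S \<union> N" "N \<subseteq> N'" "N' \<in> null_sets lborel" "S \<in> sets lborel"
      by (auto elim: sets_completionE)
    have "AE x in lborel. x \<notin> N'"
      using N(3) by (rule AE_not_in)
    then have "AE x in lebesgue. x \<notin> N'"
      by (rule AE_completion)
    then have AE: "AE x in unit_measure. x \<notin> N'"
      by (subst AE_restrict_space_iff) auto
    have S: "S \<inter> {0<..<1} = S"
      using N \<open>A \<subseteq> {0<..<1}\<close> by auto
    have "set_lebesgue_integral unit_measure A f = set_lebesgue_integral unit_measure S f"
    proof (rule set_integral_cong_set)
      show "set_borel_measurable unit_measure S f" "set_borel_measurable unit_measure A f"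
        unfolding set_borel_measurable_def
        using f A sets[of S] N S by (auto intro!: borel_measurable_scaleR borel_measurable_indicator)
      show "AE x in unit_measure. (x \<in> S) = (x \<in> A)"
        using AE by eventually_elim (use N in auto)
    qed
    also have "\<dots> = I S"
      by (simp add: I_def S)
    finally show "set_lebesgue_integral unit_measure A f = 0"
      using borel N by simp
  qed
qed

section \<open>Weak and classical derivatives\<close>

lemma continuous_integral_unit:
  fixes f :: "real \<Rightarrow> 'a::euclidean_space"
  assumes "continuous_on {0..1} f"
  shows "integrable unit_measure f" "integral\<^sup>L unit_measure f = integral {0..1} f"
proof -
  have "integrable (lebesgue_on {0..1}) f"
    using continuous_imp_integrable[of 0 1 f] assms by simp
  then have "set_integrable lebesgue {0..1} f"
    by (simp add: integrable_restrict_space set_integrable_def)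
  then have "set_integrable lebesgue {0<..<1} f"
    by (rule set_integrable_subset) auto
  then show int: "integrable unit_measure f"
    by (simp add: integrable_restrict_space set_integrable_def)
  then have "integral\<^sup>L unit_measure f = integral {0<..<1} f"
    by (intro lebesgue_integral_eq_integral) auto
  also have "\<dots> = integral {0..1} f"
    using integral_open_interval[of 0 1 f] by simp
  finally show "integral\<^sup>L unit_measure f = integral {0..1} f" .
qed

lemma square_integrable_continuous:
  assumes "continuous_on {0..1} f"
  shows "square_integrable f"
  unfolding square_integrable_def
  using continuous_integral_unit(1)[OF assms]
  by (auto intro!: continuous_integral_unit(1) continuous_intros assms)

lemma square_integrable_const: "square_integrable (\<lambda>x. c)"
  by (intro square_integrable_continuous continuous_intros)

lemma square_integrable_imp_integrable_mult:
  assumes "square_integrable f" "square_integrable g"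
  shows "integrable unit_measure (\<lambda>x. f x * g x)"
proof (rule Bochner_Integration.integrable_bound)
  show "integrable unit_measure (\<lambda>x. (cmod (f x))\<^sup>2 + (cmod (g x))\<^sup>2)"
    using assms by (auto simp: square_integrable_def)
  show "(\<lambda>x. f x * g x) \<in> borel_measurable unit_measure"
    using assms by (auto simp: square_integrable_def)
  have "cmod a * cmod b \<le> (cmod a)\<^sup>2 + (cmod b)\<^sup>2" for a b
    using sum_squares_bound[of "cmod a" "cmod b"] mult_nonneg_nonneg[of "cmod a" "cmod b"]
    by (simp del: mult_nonneg_nonneg)
  then show "AE x in unit_measure. norm (f x * g x) \<le> norm ((cmod (f x))\<^sup>2 + (cmod (g x))\<^sup>2)"
    by (intro AE_I2) (simp add: norm_mult)
qed

lemma square_integrable_imp_integrable: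
  assumes "square_integrable f"
  shows "integrable unit_measure f"
  using square_integrable_imp_integrable_mult[OF assms square_integrable_const[of 1]] by simp

text \<open>The continuous function \<open>cmod (f x - g x)\<close> has integral 0, hence vanishes
  on the whole closed interval. This makes boundary values independent of the choice of continuous
  representative.\<close>

lemma continuous_AE_eq_imp_eq:
  fixes f g :: "real \<Rightarrow> complex"
  assumes "continuous_on {0..1} f" "continuous_on {0..1} g"
    and "AE x in unit_measure. f x = g x" "x \<in> {0..1}"
  shows "f x = g x"
proof -
  have cont: "continuous_on {0..1} (\<lambda>x. cmod (f x - g x))"
    by (intro continuous_intros assms)
  have "integral {0..1} (\<lambda>x. cmod (f x - g x)) = (LINT x|unit_measure. cmod (f x - g x))"
    using continuous_integral_unit(2)[OF cont] by simp
  also have "\<dots> = 0"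
    using assms(3) by (intro integral_eq_zero_AE) auto
  finally show ?thesis
    using integral_eq_0_iff[OF cont] assms(4) by auto
qed

lemma test_function_continuous:
  assumes "test_function \<phi>"
  shows "continuous_on A \<phi>" "continuous_on A (deriv \<phi>)"
  using assms smooth_imp_DERIV smooth_deriv unfolding test_function_iff
  by (meson DERIV_isCont continuous_at_imp_continuous_on)+

lemma test_function_integrable_mult:
  assumes "test_function \<phi>" "square_integrable f"
  shows "integrable unit_measure (\<lambda>x. f x * complex_of_real (\<phi> x))"
    "integrable unit_measure (\<lambda>x. f x * complex_of_real (deriv \<phi> x))"
  using assms
  by (auto intro!: square_integrable_imp_integrable_mult square_integrable_continuous
      continuous_intros test_function_continuous)

section \<open>Classes of functions and uniqueness of weak derivatives\<close>

lemma L2_class_cases: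
  obtains f where "square_integrable f" "y = L2_class f"
  by (induction y rule: L2.abs_induct) (auto simp: L2_eq_def)

lemma L2_class_eq_iff:
  assumes "square_integrable f" "square_integrable g"
  shows "L2_class f = L2_class g \<longleftrightarrow> (AE x in unit_measure. f x = g x)"
  using Quotient_rel[OF Quotient_L2, of f g] assms by (auto simp: L2_eq_def)

lemma represents_iff: "represents f y \<longleftrightarrow> square_integrable f \<and> y = L2_class f"
proof -
  obtain g where g: "square_integrable g" "y = L2_class g"
    by (rule L2_class_cases)
  then have "represents f y \<longleftrightarrow> L2_eq f g"
    by (simp add: represents.abs_eq L2_eq_def)
  then show ?thesis
    using g L2_class_eq_iff[of f g] by (auto simp: L2_eq_def)
qed

lemma L2_class_ops:
  assumes "square_integrable f"
  shows "c *\<^sub>C L2_class f = L2_class (\<lambda>x. c * f x)"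
    "square_integrable g \<Longrightarrow> L2_class f + L2_class g = L2_class (\<lambda>x. f x + g x)"
    "square_integrable g \<Longrightarrow> L2_class f - L2_class g = L2_class (\<lambda>x. f x - g x)"
  using assms by (simp_all add: scaleC.abs_eq plus_L2.abs_eq minus_L2.abs_eq L2_eq_def)

lemma has_weak_deriv_class_iff:
  assumes "square_integrable f" "square_integrable g"
  shows "has_weak_deriv (L2_class f) (L2_class g) \<longleftrightarrow> (\<forall>\<phi>. test_function \<phi> \<longrightarrow>
     (LINT x|unit_measure. f x * complex_of_real (deriv \<phi> x)) =
     - (LINT x|unit_measure. g x * complex_of_real (\<phi> x)))"
  using assms by (simp add: has_weak_deriv.abs_eq L2_eq_def)

lemma has_weak_deriv_diff:
  assumes "has_weak_deriv u u'" "has_weak_deriv v v'"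
  shows "has_weak_deriv (u - v) (u' - v')"
proof -
  obtain f f' g g' where [simp]: "u = L2_class f" "u' = L2_class f'" "v = L2_class g" "v' = L2_class g'"
    and si: "square_integrable f" "square_integrable f'" "square_integrable g" "square_integrable g'"
    by (metis L2_class_cases)
  show ?thesis
    using assms si
    by (simp add: L2_class_ops has_weak_deriv_class_iff square_integrable_diff left_diff_distrib
        test_function_integrable_mult)
qed

lemma has_weak_deriv_scale:
  assumes "has_weak_deriv u v"
  shows "has_weak_deriv (c *\<^sub>C u) (c *\<^sub>C v)"
proof -
  obtain f g where [simp]: "u = L2_class f" "v = L2_class g"
    and si: "square_integrable f" "square_integrable g"
    by (metis L2_class_cases)
  show ?thesis
    using assms si
    by (simp add: L2_class_ops has_weak_deriv_class_iff square_integrable_scale mult.assoc)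
qed

lemma zero_L2_eq: "0 = L2_class (\<lambda>x. 0)"
  by (simp add: zero_L2_def)

text \<open>A weak derivative of 0 is orthogonal to every test function.\<close>

lemma has_weak_deriv_0_imp_0:
  assumes "has_weak_deriv 0 v"
  shows "v = 0"
proof -
  obtain g where [simp]: "v = L2_class g" and g: "square_integrable g"
    by (metis L2_class_cases)
  have "AE x in unit_measure. g x = 0"
    using assms g
    by (intro test_function_orthogonal_imp_AE_0 square_integrable_imp_integrable)
      (auto simp: zero_L2_eq has_weak_deriv_class_iff square_integrable_0)
  then show ?thesis
    using g by (simp add: zero_L2_eq L2_class_eq_iff square_integrable_0)
qed

text \<open>Two weak derivatives of \<open>u\<close> differ by a weak derivative of
  \<open>u - u = 0\<close>, hence agree; this makes the description in \<open>weak_deriv\<close>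
  usable.\<close>

lemma weak_deriv_eq:
  assumes "has_weak_deriv u v"
  shows "weak_deriv u = v"
  unfolding weak_deriv_def
  using assms has_weak_deriv_0_imp_0 has_weak_deriv_diff[OF assms]
  by (intro the_equality) (auto, metis diff_self eq_iff_diff_eq_0)

text \<open>The du Bois-Reymond argument: \<open>f\<close> annihilates derivatives of test
  functions, that is, test functions of mean zero. Subtracting a multiple of one fixed test function
  makes any test function mean zero, so integrating against \<open>f\<close> is \<open>C\<close>
  times integrating against 1.\<close>

theorem has_weak_deriv_0_imp_const:
  assumes "has_weak_deriv u 0"
  obtains C where "u = L2_class (\<lambda>x. C)"
proof -
  obtain f where u: "u = L2_class f" and f: "square_integrable f"
    by (metis L2_class_cases)
  define \<psi>\<^sub>0 where "\<psi>\<^sub>0 = bump 1 (1/3) (2/3)"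
  have test0: "test_function \<psi>\<^sub>0"
    unfolding \<psi>\<^sub>0_def by (intro test_function_bump) auto
  define J where "J = integral {0..1} \<psi>\<^sub>0"
  have "J \<noteq> 0"
  proof
    assume "J = 0"
    then have "\<forall>x\<in>{0..1}. \<psi>\<^sub>0 x = 0"
      using integral_eq_0_iff[of 0 1 \<psi>\<^sub>0] test_function_continuous(1)[OF test0]
      by (simp add: J_def \<psi>\<^sub>0_def bump_def flat_def)
    from this[rule_format, of "1/2"] have "\<psi>\<^sub>0 (1/2) = 0"
      by simp
    then show False
      by (simp add: \<psi>\<^sub>0_def bump_def flat_def)
  qed
  have LINT: "(LINT x|unit_measure. complex_of_real (\<psi> x)) = complex_of_real (integral {0..1} \<psi>)"
    if "test_function \<psi>" for \<psi>
    using continuous_integral_unit(2)[of \<psi>] test_function_continuous[OF that] by simp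
  \<comment> \<open>This is the only candidate: a constant function \<open>C\<close> has integral
    \<open>C * J\<close> against \<open>\<psi>\<^sub>0\<close>.\<close>
  define C where "C = (LINT x|unit_measure. f x * complex_of_real (\<psi>\<^sub>0 x)) / J"
  have "AE x in unit_measure. f x - C = 0"
  proof (rule test_function_orthogonal_imp_AE_0)
    show "integrable unit_measure (\<lambda>x. f x - C)"
      by (intro square_integrable_imp_integrable square_integrable_diff f square_integrable_const)
    fix \<psi>
    assume test: "test_function \<psi>"
    \<comment> \<open>Chosen so that \<open>\<psi> - c * \<psi>\<^sub>0\<close> has integral 0 and
      thus a test function as antiderivative.\<close>
    define c where "c = integral {0..1} \<psi> / J"
    have "((\<lambda>x. \<psi> x - c * \<psi>\<^sub>0 x) has_integral integral {0..1} \<psi> - c * J) {0..1}"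
      unfolding J_def
      by (intro has_integral_diff has_integral_mult_right integrable_integral
          integrable_continuous_interval test_function_continuous test test0)
    then have "((\<lambda>x. \<psi> x - c * \<psi>\<^sub>0 x) has_integral 0) {0..1}"
      using \<open>J \<noteq> 0\<close> by (simp add: c_def)
    then obtain \<phi> where \<phi>: "test_function \<phi>" "deriv \<phi> = (\<lambda>x. \<psi> x - c * \<psi>\<^sub>0 x)"
      using test_function_antiderivative[OF test_function_diff_cmult[OF test test0]] by metis
    then have "(LINT x|unit_measure. f x * complex_of_real (\<psi> x - c * \<psi>\<^sub>0 x)) = 0"
      using assms f u by (auto simp: zero_L2_eq has_weak_deriv_class_iff square_integrable_0)
    moreover have "(LINT x|unit_measure. f x * complex_of_real (\<psi> x - c * \<psi>\<^sub>0 x)) =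
        (LINT x|unit_measure. f x * complex_of_real (\<psi> x) - c * (f x * complex_of_real (\<psi>\<^sub>0 x)))"
      by (intro Bochner_Integration.integral_cong) (auto simp: algebra_simps)
    ultimately have "(LINT x|unit_measure. f x * complex_of_real (\<psi> x)) = c * (C * J)"
      using \<open>J \<noteq> 0\<close> f test test0 by (simp add: test_function_integrable_mult C_def)
    moreover have "c * (C * J) = C * (LINT x|unit_measure. complex_of_real (\<psi> x))"
      using \<open>J \<noteq> 0\<close> unfolding LINT[OF test] by (simp add: c_def)
    ultimately show "(LINT x|unit_measure. (f x - C) * complex_of_real (\<psi> x)) = 0"
      using test_function_integrable_mult(1)[OF test f]
        test_function_integrable_mult(1)[OF test square_integrable_const[of C]]
      by (simp add: left_diff_distrib)
  qed
  then have "u = L2_class (\<lambda>x. C)"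
    using f u by (simp add: L2_class_eq_iff square_integrable_const)
  then show thesis ..
qed

text \<open>Integration by parts; the boundary terms drop out because test functions vanish at 0 and
  1.\<close>

lemma has_weak_deriv_classical:
  assumes cont: "continuous_on {0..1} f" "continuous_on {0..1} f'"
    and deriv: "\<And>x. x \<in> {0<..<1} \<Longrightarrow> (f has_vector_derivative f' x) (at x)"
  shows "has_weak_deriv (L2_class f) (L2_class f')"
  unfolding has_weak_deriv_class_iff[OF cont[THEN square_integrable_continuous]]
proof (intro allI impI)
  fix \<phi>
  assume test: "test_function \<phi>"
  then have bd: "\<phi> 0 = 0" "\<phi> 1 = 0"
    unfolding test_function_iff by auto
  have D: "(\<phi> has_field_derivative deriv \<phi> x) (at x)" for x
    using test smooth_imp_DERIV by (simp add: test_function_iff)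
  have "((\<lambda>x. f x * complex_of_real (deriv \<phi> x) + f' x * complex_of_real (\<phi> x)) has_integral
      f 1 * complex_of_real (\<phi> 1) - f 0 * complex_of_real (\<phi> 0)) {0..1}"
    by (intro fundamental_theorem_of_calculus_interior has_vector_derivative_mult
        has_vector_derivative_of_real deriv D continuous_intros cont test_function_continuous test) auto
  then have "integral {0..1} (\<lambda>x. f x * complex_of_real (deriv \<phi> x) + f' x * complex_of_real (\<phi> x)) = 0"
    using bd by (simp add: integral_unique)
  also have "integral {0..1} (\<lambda>x. f x * complex_of_real (deriv \<phi> x) + f' x * complex_of_real (\<phi> x)) =
      (LINT x|unit_measure. f x * complex_of_real (deriv \<phi> x) + f' x * complex_of_real (\<phi> x))"
    by (intro continuous_integral_unit(2)[symmetric] continuous_intros cont test_function_continuous test)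
  finally show "(LINT x|unit_measure. f x * complex_of_real (deriv \<phi> x)) =
      - (LINT x|unit_measure. f' x * complex_of_real (\<phi> x))"
    by (simp add: test_function_integrable_mult[OF test] square_integrable_continuous cont
        eq_neg_iff_add_eq_0)
qed

text \<open>The primitive \<open>g\<close> of \<open>f'\<close> also has weak derivative
  \<open>v\<close>, so \<open>f\<close> and \<open>g\<close> differ by a constant almost everywhere,
  and by continuity everywhere. Hence \<open>f\<close> inherits the classical derivative of
  \<open>g\<close>.\<close>

lemma has_weak_deriv_imp_classical:
  assumes "has_weak_deriv u v" "represents f u" "represents f' v"
    and cont: "continuous_on {0..1} f" "continuous_on {0..1} f'"
    and x: "x \<in> {0<..<1}"
  shows "(f has_vector_derivative f' x) (at x)"
proof -
  define g where "g x = integral {0..x} f'" for x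
  have D: "(g has_vector_derivative f' x) (at x within {0..1})" if "x \<in> {0..1}" for x
    unfolding g_def using that by (intro integral_has_vector_derivative cont)
  then have contg: "continuous_on {0..1} g"
    by (rule continuous_on_vector_derivative)
  have Dg: "(g has_vector_derivative f' x) (at x)" if "x \<in> {0<..<1}" for x
    using D[of x] that at_within_Icc_at[of 0 x 1] by auto
  then have "has_weak_deriv (L2_class g) v"
    using assms(3) has_weak_deriv_classical[OF contg cont(2)] by (simp add: represents_iff)
  from has_weak_deriv_diff[OF assms(1) this] obtain C where "u - L2_class g = L2_class (\<lambda>x. C)"
    using has_weak_deriv_0_imp_const by auto
  then have "L2_class f = L2_class g + L2_class (\<lambda>x. C)"
    using assms(2) by (simp add: represents_iff algebra_simps)
  also have "\<dots> = L2_class (\<lambda>x. g x + C)"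
    by (simp add: L2_class_ops square_integrable_continuous contg square_integrable_const)
  finally have "AE x in unit_measure. f x = g x + C"
    by (subst (asm) L2_class_eq_iff)
      (auto intro!: square_integrable_continuous continuous_intros cont contg)
  then have eq: "f x = g x + C" if "x \<in> {0..1}" for x
    using that by (intro continuous_AE_eq_imp_eq continuous_intros cont contg)
  have "((\<lambda>x. g x + C) has_vector_derivative f' x) (at x)"
    using Dg[OF x] by (auto intro!: derivative_eq_intros)
  then show ?thesis
    by (rule has_vector_derivative_transform_within_open[where S = "{0<..<1}"]) (use x eq in auto)
qed

section \<open>Periodic solutions of the differential equation\<close>

lemma vector_derivative_0_imp_const:
  fixes f :: "real \<Rightarrow> 'a::banach"
  assumes "continuous_on {0..1} f" "\<And>x. x \<in> {0<..<1} \<Longrightarrow> (f has_vector_derivative 0) (at x)"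
    and "x \<in> {0..1}"
  shows "f x = f 0"
proof -
  have "((\<lambda>x. 0) has_integral f x - f 0) {0..x}"
    using assms by (intro fundamental_theorem_of_calculus_interior) (auto intro: continuous_on_subset)
  then show ?thesis
    by simp
qed

lemma periodic_const_derivative:
  fixes f :: "real \<Rightarrow> 'a::banach"
  assumes cont: "continuous_on {0..1} f" and per: "f 1 = f 0"
    and deriv: "\<And>x. x \<in> {0<..<1} \<Longrightarrow> (f has_vector_derivative c) (at x)"
  shows "c = 0" "x \<in> {0..1} \<Longrightarrow> f x = f 0"
proof -
  have "((\<lambda>x. c) has_integral f 1 - f 0) {0..1::real}"
    using cont deriv by (intro fundamental_theorem_of_calculus_interior) auto
  from has_integral_unique[OF this has_integral_const_real] show "c = 0"
    by (simp add: per)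
  with deriv show "x \<in> {0..1} \<Longrightarrow> f x = f 0"
    by (intro vector_derivative_0_imp_const[OF cont]) auto
qed

text \<open>The integrating factor \<open>exp (- a * x)\<close> makes \<open>w\<close> constant;
  evaluating the resulting formula at 1 and using periodicity gives the alternative.\<close>

lemma linear_ode_periodic:
  fixes v :: "real \<Rightarrow> complex"
  assumes cont: "continuous_on {0..1} v"
    and deriv: "\<And>x. x \<in> {0<..<1} \<Longrightarrow> (v has_vector_derivative a * v x) (at x)"
    and per: "v 1 = v 0"
  shows "x \<in> {0..1} \<Longrightarrow> v x = v 0 * exp (a * x)" "v 0 = 0 \<or> exp a = 1"
proof -
  define w where "w x = v x * exp (- a * complex_of_real x)" for x
  have E: "((\<lambda>x. exp (- a * complex_of_real x)) has_vector_derivative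
      - a * exp (- a * complex_of_real x)) (at x)" for x
    by (rule has_vector_derivative_real_field) (auto intro!: derivative_eq_intros)
  then have "(w has_vector_derivative 0) (at x)" if "x \<in> {0<..<1}" for x
    using has_vector_derivative_mult[OF deriv[OF that] E] unfolding w_def
    by (auto simp: algebra_simps)
  moreover have "continuous_on {0..1} w"
    unfolding w_def by (intro continuous_intros cont)
  ultimately have w: "w x = w 0" if "x \<in> {0..1}" for x
    using that by (intro vector_derivative_0_imp_const)
  have v: "v x = v 0 * exp (a * x)" if "x \<in> {0..1}" for x
  proof -
    have "v x = w x * exp (a * x)"
      by (simp add: w_def mult.assoc flip: exp_add)
    moreover have "w 0 = v 0"
      by (simp add: w_def)
    ultimately show ?thesis
      using w[OF that] by simp
  qed
  then show "x \<in> {0..1} \<Longrightarrow> v x = v 0 * exp (a * x)" .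
  show "v 0 = 0 \<or> exp a = 1"
    using v[of 1] per by auto
qed

text \<open>\<open>exp a = 1\<close> makes \<open>a\<close> purely imaginary, so the real part of
  \<open>a * \<omega>\<close> is \<open>- Im a * Im \<omega>\<close>, which is nonzero. Hence no two
  cube roots of a nonzero number both satisfy \<open>exp a = 1\<close>.\<close>

lemma exp_eq_1_imp_exp_mult_neq_1:
  assumes "exp a = 1" "a \<noteq> 0" "Im \<omega> \<noteq> 0"
  shows "exp (a * \<omega>) \<noteq> 1"
proof
  assume "exp (a * \<omega>) = 1"
  then have "Re (a * \<omega>) = 0" "Re a = 0"
    using assms(1) by (auto simp: exp_eq_1)
  then show False
    using assms(2,3) by (auto simp: complex_eq_iff)
qed

lemma cube_root_unity:
  obtains \<omega> :: complex where "\<omega> ^ 2 + \<omega> + 1 = 0" "\<omega> ^ 3 = 1" "Im \<omega> \<noteq> 0" "Im (\<omega> ^ 2) \<noteq> 0"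
proof
  let ?w = "Complex (-1/2) (sqrt 3 / 2)"
  show *: "?w ^ 2 + ?w + 1 = 0"
    by (simp add: complex_eq_iff power2_eq_square)
  have "?w ^ 3 - 1 = (?w - 1) * (?w ^ 2 + ?w + 1)"
    by (simp add: algebra_simps power2_eq_square power3_eq_cube)
  then show "?w ^ 3 = 1"
    using * by simp
  show "Im ?w \<noteq> 0" "Im (?w ^ 2) \<noteq> 0"
    by (auto simp: power2_eq_square)
qed

section \<open>The periodic problem for the equation y''' = kappa y\<close>

locale periodic_cubic_ode =
  fixes y y' y'' :: "real \<Rightarrow> complex" and \<kappa> :: complex
  assumes cont: "continuous_on {0..1} y" "continuous_on {0..1} y'" "continuous_on {0..1} y''"
    and per: "y 1 = y 0" "y' 1 = y' 0" "y'' 1 = y'' 0"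
    and deriv: "\<And>x. x \<in> {0<..<1} \<Longrightarrow> (y has_vector_derivative y' x) (at x)"
      "\<And>x. x \<in> {0<..<1} \<Longrightarrow> (y' has_vector_derivative y'' x) (at x)"
      "\<And>x. x \<in> {0<..<1} \<Longrightarrow> (y'' has_vector_derivative \<kappa> * y x) (at x)"
begin

text \<open>The factor \<open>D\<^sup>2 + aD + a\<^sup>2\<close> of \<open>D\<^sup>3 - a\<^sup>3\<close>, applied to \<open>y\<close>; it is annihilated by \<open>D - a\<close>.\<close>

definition v :: "complex \<Rightarrow> real \<Rightarrow> complex" where
  "v a x = y'' x + a * y' x + a ^ 2 * y x"

lemma v_solution:
  assumes "a ^ 3 = \<kappa>"
  shows "x \<in> {0..1} \<Longrightarrow> v a x = v a 0 * exp (a * x)" "v a 0 = 0 \<or> exp a = 1"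
proof -
  have "continuous_on {0..1} (v a)"
    unfolding v_def by (intro continuous_intros cont)
  moreover have "(v a has_vector_derivative a * v a x) (at x)" if "x \<in> {0<..<1}" for x
    unfolding v_def using assms
    by (auto intro!: derivative_eq_intros deriv[OF that]
        simp: algebra_simps power2_eq_square power3_eq_cube)
  moreover have "v a 1 = v a 0"
    by (simp add: v_def per)
  ultimately show "x \<in> {0..1} \<Longrightarrow> v a x = v a 0 * exp (a * x)" "v a 0 = 0 \<or> exp a = 1"
    using linear_ode_periodic(1)[of "v a" a x] linear_ode_periodic(2)[of "v a" a] by blast+
qed

text \<open>Summed over the three cube roots, the coefficients of \<open>y''\<close> and
  \<open>y'\<close> contain the vanishing factor \<open>\<omega> ^ 2 + \<omega> + 1\<close>, while
  each term contributes \<open>a ^ 3 = \<kappa>\<close> to the coefficient of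
  \<open>y\<close>.\<close>

lemma sum_v:
  assumes "a ^ 3 = \<kappa>" "\<omega> ^ 2 + \<omega> + 1 = 0"
  shows "a * v a x + a * \<omega> * v (a * \<omega>) x + a * \<omega> ^ 2 * v (a * \<omega> ^ 2) x = 3 * \<kappa> * y x"
proof -
  have "\<omega> ^ 3 - 1 = (\<omega> - 1) * (\<omega> ^ 2 + \<omega> + 1)"
    by (simp add: algebra_simps power2_eq_square power3_eq_cube)
  then have w3: "\<omega> ^ 3 = 1"
    using assms(2) by simp
  have "a * v a x + a * \<omega> * v (a * \<omega>) x + a * \<omega> ^ 2 * v (a * \<omega> ^ 2) x =
      a * (\<omega> ^ 2 + \<omega> + 1) * y'' x + a ^ 2 * (\<omega> ^ 2 + \<omega> ^ 3 * \<omega> + 1) * y' x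
      + a ^ 3 * (1 + \<omega> ^ 3 + \<omega> ^ 3 * \<omega> ^ 3) * y x"
    by (simp add: v_def algebra_simps power2_eq_square power3_eq_cube)
  also have "\<dots> = 3 * \<kappa> * y x"
    using assms by (simp add: w3)
  finally show ?thesis .
qed

text \<open>The other two roots \<open>a * \<omega>\<close> and \<open>a * \<omega> ^ 2\<close> do
  not have exponential 1, so their \<open>v\<close> vanishes and \<open>sum_v\<close> leaves
  \<open>3 * \<kappa> * y x = a * v a x\<close>.\<close>

lemma solution_exp:
  assumes a: "a ^ 3 = \<kappa>" "exp a = 1" "a \<noteq> 0"
  shows "\<exists>c. \<forall>x\<in>{0..1}. y x = c * exp (a * x)"
proof -
  obtain \<omega> :: complex where \<omega>: "\<omega> ^ 2 + \<omega> + 1 = 0" "\<omega> ^ 3 = 1" "Im \<omega> \<noteq> 0" "Im (\<omega> ^ 2) \<noteq> 0"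
    by (rule cube_root_unity)
  have 0: "v (a * b) x = 0" if "b ^ 3 = 1" "Im b \<noteq> 0" "x \<in> {0..1}" for b x
    using v_solution(1)[of "a * b" x] v_solution(2)[of "a * b"] that a exp_eq_1_imp_exp_mult_neq_1[of a b]
    by (simp add: power_mult_distrib)
  have "(\<omega> ^ 2) ^ 3 = 1"
    using \<omega>(2) power_mult[of \<omega> 3 2] power_mult[of \<omega> 2 3] by simp
  then have "y x = a * v a 0 / (3 * \<kappa>) * exp (a * x)" if "x \<in> {0..1}" for x
    using sum_v[OF a(1) \<omega>(1), of x] 0[of \<omega> x] 0[of "\<omega> ^ 2" x] \<omega> that a v_solution(1)[of a x]
    by (auto simp: field_simps)
  then show ?thesis
    by blast
qed

lemma solution_cases:
  shows "(\<forall>x\<in>{0..1}. y x = 0) \<or> (\<exists>a c. a ^ 3 = \<kappa> \<and> exp a = 1 \<and> (\<forall>x\<in>{0..1}. y x = c * exp (a * x)))"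
proof (cases "\<kappa> = 0")
  case True
  \<comment> \<open>Here \<open>y''\<close> is constant; periodicity of \<open>y'\<close> and then
    of \<open>y\<close> kills the constant derivatives one after the other.\<close>
  have y'': "y'' x = y'' 0" if "x \<in> {0..1}" for x
    using that deriv(3) True by (intro vector_derivative_0_imp_const[OF cont(3)]) auto
  have "(y' has_vector_derivative y'' 0) (at x)" if "x \<in> {0<..<1}" for x
    using deriv(2)[OF that] y''[of x] that by simp
  then have y': "y' x = y' 0" if "x \<in> {0..1}" for x
    using that by (rule periodic_const_derivative(2)[OF cont(2) per(2)])
  have "(y has_vector_derivative y' 0) (at x)" if "x \<in> {0<..<1}" for x
    using deriv(1)[OF that] y'[of x] that by simp
  then have y: "y x = y 0" if "x \<in> {0..1}" for x
    using that by (rule periodic_const_derivative(2)[OF cont(1) per(1)])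
  show ?thesis
  proof (intro disjI2 exI conjI ballI)
    show "0 ^ 3 = \<kappa>" "exp 0 = (1 :: complex)"
      using True by simp_all
    show "y x = y 0 * exp (0 * complex_of_real x)" if "x \<in> {0..1}" for x
      using y[OF that] by simp
  qed
next
  case False
  show ?thesis
  proof (cases "\<exists>a. a ^ 3 = \<kappa> \<and> exp a = 1")
    case True
    then obtain a where a: "a ^ 3 = \<kappa>" "exp a = 1"
      by blast
    with False solution_exp[of a] show ?thesis
      by auto
  next
    case no_root: False
    obtain \<omega> :: complex where \<omega>: "\<omega> ^ 2 + \<omega> + 1 = 0" "\<omega> ^ 3 = 1"
      by (rule cube_root_unity)
    \<comment> \<open>Any cube root of \<open>\<kappa>\<close> serves: none of the three has
      exponential 1, so all three \<open>v\<close> vanish and \<open>sum_v\<close> gives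
      \<open>y = 0\<close>.\<close>
    define a where "a = exp (Ln \<kappa> / 3)"
    have a: "a ^ 3 = \<kappa>"
      using False by (simp add: a_def exp_of_nat_mult[symmetric])
    have v0: "v b x = 0" if "b ^ 3 = \<kappa>" "x \<in> {0..1}" for b x
      using v_solution(1)[of b x] v_solution(2)[of b] no_root that by auto
    have "(\<omega> ^ 2) ^ 3 = 1"
      using \<omega>(2) power_mult[of \<omega> 3 2] power_mult[of \<omega> 2 3] by simp
    then have "(a * \<omega>) ^ 3 = \<kappa>" "(a * \<omega> ^ 2) ^ 3 = \<kappa>"
      unfolding power_mult_distrib a \<omega>(2) by simp_all
    then have "y x = 0" if "x \<in> {0..1}" for x
      using sum_v[OF a \<omega>(1), of x] v0[OF _ that] a False by simp
    then have "\<forall>x\<in>{0..1}. y x = 0"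
      by blast
    then show ?thesis ..
  qed
qed

end

section \<open>Eigenvalues and eigenfunctions\<close>

lemma continuous_on_exp_of_real: "continuous_on A (\<lambda>x. exp (a * complex_of_real x))"
  by (intro continuous_intros)

text \<open>The scalar \<open>c\<close> is carried along so that the rule can be iterated to give
  all higher weak derivatives.\<close>

lemma has_weak_deriv_un:
  "has_weak_deriv (c *\<^sub>C un n) ((c * (2 * of_int n * complex_of_real pi * \<i>)) *\<^sub>C un n)"
proof -
  let ?a = "2 * of_int n * complex_of_real pi * \<i>"
  have "((\<lambda>x. exp (?a * complex_of_real x)) has_vector_derivative ?a * exp (?a * complex_of_real x)) (at x)" for x
    by (rule has_vector_derivative_real_field) (auto intro!: derivative_eq_intros)
  then have "has_weak_deriv (un n) (L2_class (\<lambda>x. ?a * exp (?a * complex_of_real x)))"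
    unfolding un_def by (intro has_weak_deriv_classical continuous_intros)
  also have "L2_class (\<lambda>x. ?a * exp (?a * complex_of_real x)) = ?a *\<^sub>C un n"
    unfolding un_def
    by (intro L2_class_ops(1)[symmetric] square_integrable_continuous continuous_on_exp_of_real)
  finally show ?thesis
    using has_weak_deriv_scale[of "un n" "?a *\<^sub>C un n" c] by (simp add: L2.scale_scale)
qed

lemma weak_deriv_power_un:
  "(weak_deriv ^^ k) (c *\<^sub>C un n) = (c * (2 * of_int n * complex_of_real pi * \<i>) ^ k) *\<^sub>C un n"
  by (induction k) (simp_all add: weak_deriv_eq[OF has_weak_deriv_un] mult_ac)

lemma exp_2_of_int_pi: "exp (2 * of_int n * complex_of_real pi * \<i>) = 1"
  unfolding exp_eq_1 by (auto intro!: exI[of _ n])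

lemma periodic_boundary_un: "periodic_boundary (c *\<^sub>C un n)"
  unfolding periodic_boundary_def
proof (intro exI conjI)
  let ?F = "\<lambda>x. c * exp (2 * of_int n * complex_of_real pi * \<i> * complex_of_real x)"
  show cont: "continuous_on {0..1} ?F"
    by (intro continuous_intros)
  show "represents ?F (c *\<^sub>C un n)"
    using cont by (simp add: represents_iff square_integrable_continuous un_def L2_class_ops
        continuous_on_exp_of_real)
  show "?F 1 = ?F 0"
    by (simp add: exp_2_of_int_pi)
qed

lemma zn_eq: "zn n = \<i> * (2 * of_int n * complex_of_real pi * \<i>) ^ 3"
proof -
  have "\<i> ^ 3 = - \<i>"
    by (simp add: power3_eq_cube)
  then show ?thesis
    by (simp add: zn_def power_mult_distrib)
qed

lemma un_in_L0_domain: "c *\<^sub>C un n \<in> L0_domain"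
proof -
  have "\<exists>g. has_weak_deriv ((weak_deriv ^^ j) (c *\<^sub>C un n)) g" for j
    unfolding weak_deriv_power_un using has_weak_deriv_un by blast
  moreover have "periodic_boundary ((weak_deriv ^^ j) (c *\<^sub>C un n))" for j
    unfolding weak_deriv_power_un by (rule periodic_boundary_un)
  from this[of 0] this[of 1] this[of 2] have "periodic_boundary (c *\<^sub>C un n)"
    "periodic_boundary (weak_deriv (c *\<^sub>C un n))" "periodic_boundary ((weak_deriv ^^ 2) (c *\<^sub>C un n))"
    by simp_all
  ultimately show ?thesis
    unfolding L0_domain_def sobolev_def by blast
qed

lemma L0_un: "L0 (c *\<^sub>C un n) = zn n *\<^sub>C (c *\<^sub>C un n)"
  by (simp add: L0_def weak_deriv_power_un L2.scale_scale zn_eq mult_ac)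

text \<open>Being zero almost everywhere would force the continuous exponential to vanish at 0,
  where it equals 1.\<close>

lemma un_nonzero: "un n \<noteq> 0"
proof
  let ?e = "\<lambda>x. exp (2 * of_int n * complex_of_real pi * \<i> * complex_of_real x)"
  assume "un n = 0"
  then have "AE x in unit_measure. ?e x = 0"
    unfolding un_def zero_L2_eq
    by (subst (asm) L2_class_eq_iff)
      (auto intro!: square_integrable_continuous square_integrable_0 continuous_intros)
  then have "?e 0 = 0"
    by (intro continuous_AE_eq_imp_eq continuous_intros) auto
  then show False
    by simp
qed

text \<open>The eigenvalue equation is transferred to the continuous representatives of
  \<open>y\<close> and its first two weak derivatives, where the classical analysis of
  \<open>periodic_cubic_ode\<close> applies.\<close>

lemma L0_eigenvector:
  assumes y: "y \<in> L0_domain" "L0 y = z *\<^sub>C y" and "y \<noteq> 0"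
  obtains n c where "z = zn n" "y = c *\<^sub>C un n"
proof -
  define Y where "Y k = (weak_deriv ^^ k) y" for k
  have deriv: "has_weak_deriv (Y k) (Y (Suc k))" if "k < 3" for k
  proof -
    obtain g where "has_weak_deriv (Y k) g"
      using y(1) \<open>k < 3\<close> unfolding L0_domain_def sobolev_def Y_def by blast
    then show ?thesis
      using weak_deriv_eq by (auto simp: Y_def)
  qed
  have "periodic_boundary (Y 0)" "periodic_boundary (Y 1)" "periodic_boundary (Y 2)"
    using y(1) by (auto simp: L0_domain_def Y_def)
  then obtain F0 F1 F2 where
    cont: "continuous_on {0..1} F0" "continuous_on {0..1} F1" "continuous_on {0..1} F2" and
    rep: "represents F0 (Y 0)" "represents F1 (Y 1)" "represents F2 (Y 2)" and
    per: "F0 1 = F0 0" "F1 1 = F1 0" "F2 1 = F2 0"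
    unfolding periodic_boundary_def by blast
  define \<kappa> where "\<kappa> = - \<i> * z"
  have "\<i> *\<^sub>C Y 3 = z *\<^sub>C y"
    using y(2) by (simp add: L0_def Y_def)
  then have "(- \<i>) *\<^sub>C (\<i> *\<^sub>C Y 3) = (- \<i>) *\<^sub>C (z *\<^sub>C y)"
    by simp
  then have "Y 3 = \<kappa> *\<^sub>C y"
    by (simp add: L2.scale_scale \<kappa>_def)
  \<comment> \<open>The domain provides no continuous representative of the third derivative; the
    eigenvalue equation itself supplies one, so \<open>F2\<close> is classically differentiable
    too.\<close>
  then have rep3: "represents (\<lambda>x. \<kappa> * F0 x) (Y 3)"
    using rep(1) by (simp add: represents_iff Y_def L2_class_ops square_integrable_scale)
  interpret periodic_cubic_ode F0 F1 F2 \<kappa>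
  proof
    show "(F0 has_vector_derivative F1 x) (at x)" if "x \<in> {0<..<1}" for x
      using has_weak_deriv_imp_classical[OF deriv[of 0]] rep cont that by simp
    show "(F1 has_vector_derivative F2 x) (at x)" if "x \<in> {0<..<1}" for x
      using has_weak_deriv_imp_classical[OF deriv[of 1]] rep cont that by (simp add: numeral_2_eq_2)
    show "(F2 has_vector_derivative \<kappa> * F0 x) (at x)" if "x \<in> {0<..<1}" for x
      using has_weak_deriv_imp_classical[OF deriv[of 2] _ _ cont(3) continuous_on_mult_left[OF cont(1)]]
        rep rep3 that by (simp add: numeral_3_eq_3 numeral_2_eq_2)
  qed (use cont per in auto)
  have y_eq: "y = L2_class G" if "\<forall>x\<in>{0..1}. F0 x = G x" for G
  proof -
    have "continuous_on {0..1} G"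
      using continuous_on_eq[OF cont(1)] that by blast
    moreover have "AE x in unit_measure. F0 x = G x"
      using that by (intro AE_I2) auto
    ultimately have "L2_class F0 = L2_class G"
      using cont(1) by (simp add: L2_class_eq_iff square_integrable_continuous)
    then show ?thesis
      using rep(1) by (simp add: represents_iff Y_def)
  qed
  have "\<not> (\<forall>x\<in>{0..1}. F0 x = 0)"
    using y_eq[of "\<lambda>x. 0"] \<open>y \<noteq> 0\<close> by (auto simp: zero_L2_eq)
  then obtain a c where a: "a ^ 3 = \<kappa>" "exp a = 1" "\<forall>x\<in>{0..1}. F0 x = c * exp (a * x)"
    using solution_cases by blast
  from a(2) obtain n where "Re a = 0" "Im a = of_int (2 * n) * pi"
    unfolding exp_eq_1 by blast
  then have n: "a = 2 * of_int n * complex_of_real pi * \<i>"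
    by (simp add: complex_eq_iff)
  have "y = c *\<^sub>C un n"
    using y_eq[OF a(3)]
    by (simp add: n un_def L2_class_ops square_integrable_continuous continuous_on_exp_of_real)
  moreover have "z = zn n"
    unfolding zn_eq n[symmetric] a(1) by (simp add: \<kappa>_def)
  ultimately show thesis
    by (rule that[rotated])
qed

text \<open>Real cube roots are unique. Distinct indices thus give distinct eigenvalues, so
  \<open>un n\<close> alone spans the eigenspace of \<open>zn n\<close>.\<close>

lemma inj_zn: "inj zn"
proof (rule injI)
  fix m n
  assume "zn m = zn n"
  then have "root 3 ((2 * of_int m * pi) ^ 3) = root 3 ((2 * of_int n * pi) ^ 3)"
    by (simp add: zn_def flip: of_real_power of_real_mult)
  then show "m = n"
    by (subst (asm) (1 2) odd_real_root_power_cancel) auto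
qed

theorem lemma3p2:
  shows "({\<mu>. eigenvalue L0_domain L0 \<mu>} = range zn \<and>
          (\<forall>n. multiplicity_eigenvalue L0_domain L0 (zn n) = 1)) \<and>
         (\<forall>n. eigenfunction L0_domain L0 (zn n) (un n) \<and>
           (\<forall>y. eigenfunction L0_domain L0 (zn n) y \<longrightarrow> (\<exists>c. y = c *\<^sub>C un n)))"
proof -
  have eigenfunction_un: "eigenfunction L0_domain L0 (zn n) (un n)" for n
    using un_in_L0_domain[of 1 n] L0_un[of 1 n] un_nonzero[of n] by (simp add: eigenfunction_def)
  have simple: "\<exists>c. y = c *\<^sub>C un n" if y: "y \<in> eigenspace L0_domain L0 (zn n)" for n y
  proof (cases "y = 0")
    case True
    then show ?thesis
      by (intro exI[of _ 0]) simp
  next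
    case False
    then obtain m c where "zn n = zn m" "y = c *\<^sub>C un m"
      using y L0_eigenvector[of y "zn n"] unfolding eigenspace_def by blast
    then show ?thesis
      using inj_zn by (auto dest: injD)
  qed
  have "{\<mu>. eigenvalue L0_domain L0 \<mu>} = range zn"
    using eigenfunction_un L0_eigenvector unfolding eigenvalue_def eigenfunction_def by blast
  moreover have "multiplicity_eigenvalue L0_domain L0 (zn n) = 1" for n
    unfolding multiplicity_eigenvalue_def
  proof (rule L2.dim_unique[where B = "{un n}"])
    show "{un n} \<subseteq> eigenspace L0_domain L0 (zn n)"
      using eigenfunction_un by (auto simp: eigenspace_def eigenfunction_def)
    show "eigenspace L0_domain L0 (zn n) \<subseteq> L2.span {un n}"
      using simple by (auto simp: L2.span_singleton image_iff)
    show "L2.independent {un n}"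
      using un_nonzero by (simp add: L2.dependent_single)
  qed simp
  moreover have "\<exists>c. y = c *\<^sub>C un n" if "eigenfunction L0_domain L0 (zn n) y" for n y
    using that simple by (simp add: eigenfunction_def eigenspace_def)
  ultimately show ?thesis
    using eigenfunction_un by blast
qed

end
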